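(* Let $N, M, k$ be integers with $M \ge 1$ and $1 \le k \le N-1$. If the real and synthetic distributions are identical, i.e., $\{x^r_i\}_{i=1}^N$ and $\{x^s_j\}_{j=1}^M$ are $N+M$ i.i.d. samples from the same distribution, then the expected value of $\mathrm{ClippedCoverage}_{\mathrm{unnorm}}$ is $$\mathbb{E}\left[\mathrm{ClippedCoverage}_{\mathrm{unnorm}}\right] = \sum_{j=1}^M \min\left(\frac{j}{k}, 1\right) \binom{M}{j} \frac{\beta(k + j,\; M - j + N - k)}{\beta(k,\; N - k)},$$ where $\beta$ is the beta function and $$\mathrm{ClippedCoverage}_{\mathrm{unnorm}} = \frac{1}{N} \sum_{i=1}^N \min\left(\frac{1}{k}\sum_{j=1}^M \mathbf{1}_{x^s_j \in B(x^r_i,\, \mathrm{NND}^r_k(x^r_i))},\; 1\right).$$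
   Context: The samples $x^r_1,\dots,x^r_N$ are called real samples and $x^s_1,\dots,x^s_M$ synthetic samples; they are points of $\mathbb{R}^d$ ($d \ge 1$), with distances given by the norm $\|\cdot\|$. For a real sample $x^r_i$, $\mathrm{NND}^r_k(x^r_i)$ denotes the distance from $x^r_i$ to its $k$-th nearest neighbor among the other real samples, i.e. the $k$-th smallest value (counted with multiplicity) among the $N-1$ numbers $\|x^r_l - x^r_i\|$, $l \in \{1,\dots,N\}\setminus\{i\}$. $B(x,\rho) = \{y \in \mathbb{R}^d : \|y - x\| \le \rho\}$ is the closed ball of center $x$ and radius $\rho$. $\mathbf{1}$ denotes the indicator function. The beta function is $\beta(a,b) = \int_0^1 t^{a-1}(1-t)^{b-1}\,dt = \Gamma(a)\Gamma(b)/\Gamma(a+b)$ for $a,b>0$.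
   Formalization: Added assumption: for almost every point x under the common distribution, every sphere centered at x has probability zero (no distance ties). Without it the formula fails: for a point mass with N=2, M=k=1 the expectation is 1 but the right side is 1/2. *)

theory Defs
  imports "HOL-Probability.Probability"
begin

text \<open>
  Samples are families indexed by the naturals from 1; only the indices
  \<open>1, \<dots>, N\<close> (respectively \<open>1, \<dots>, M\<close>) matter.
  The \<open>k\<close>-th smallest value counted with multiplicity is entry \<open>k - 1\<close> of the ascending
  list of distances, so \<open>nnd\<close> is meaningful only for \<open>1 \<le> k \<le> N - 1\<close>.
\<close>

definition nnd :: "nat \<Rightarrow> nat \<Rightarrow> (nat \<Rightarrow> real ^ 'd) \<Rightarrow> nat \<Rightarrow> real" where
  "nnd k N xr i =
     sorted_list_of_multiset {# norm (xr l - xr i). l \<in># mset_set ({1..N} - {i}) #} ! (k - 1)"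

definition clipped_coverage_unnorm ::
    "nat \<Rightarrow> nat \<Rightarrow> nat \<Rightarrow> (nat \<Rightarrow> real ^ 'd) \<Rightarrow> (nat \<Rightarrow> real ^ 'd) \<Rightarrow> real" where
  "clipped_coverage_unnorm k N M xr xs =
     1 / real N * (\<Sum>i = 1..N.
       min (1 / real k * (\<Sum>j = 1..M. indicator (cball (xr i) (nnd k N xr i)) (xs j))) 1)"

end

theory Submission
  imports Defs
begin

text \<open>
  Condition on a real sample \<open>x\<close>: the distances from \<open>x\<close> to the other samples are i.i.d.
  with an atomless law \<open>\<mu>\<close> on the reals, so almost surely they are pairwise distinct. Decompose according
  to the real sample \<open>l\<close> that is the \<open>k\<close>-th nearest neighbour, the set \<open>K\<close> of the \<open>k - 1\<close> real samples and
  the set \<open>T\<close> of the synthetic samples that are closer to \<open>x\<close> than \<open>l\<close>. By independence the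
  probability of each such configuration is \<open>\<integral> F\<^sup>s (1 - F)\<^sup>r d\<mu>\<close> with \<open>F t = \<mu> {..<t}\<close>,
  \<open>s = k - 1 + card T\<close> and \<open>r\<close> the number of remaining samples. This depends only on \<open>s\<close> and \<open>r\<close>,
  and since among \<open>s + r + 1\<close> samples exactly one has rank \<open>s\<close>, counting
  configurations shows that it equals \<open>\<beta>(s + 1, r + 1)\<close>.
\<close>

subsection \<open>The k-th smallest value of a finite family\<close>

text \<open>The entries \<open>\<le> t\<close> of a sorted list form an initial segment, so the
  question is only whether index \<open>n\<close> falls inside it.\<close>

lemma sorted_nth_le_iff:
  fixes xs :: "'a::linorder list"
  assumes "sorted xs" "n < length xs"
  shows "xs ! n \<le> t \<longleftrightarrow> n < length (filter (\<lambda>x. x \<le> t) xs)"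
  using assms
proof (induction xs arbitrary: n)
  case (Cons x xs)
  show ?case
  proof (cases "x \<le> t")
    case True
    then show ?thesis using Cons by (cases n) auto
  next
    case False
    then have "\<forall>y \<in> set (x # xs). \<not> y \<le> t"
      using Cons.prems by auto
    then have "filter (\<lambda>x. x \<le> t) (x # xs) = []" "\<not> (x # xs) ! n \<le> t"
      using Cons.prems(2) by (blast intro: filter_False, metis nth_mem)
    then show ?thesis by simp
  qed
qed simp

text \<open>The encoding of \<open>nnd\<close>, freed from distances and from the index type so that
  real and synthetic samples can share one index set.\<close>

definition kth_smallest :: "nat \<Rightarrow> 'i set \<Rightarrow> ('i \<Rightarrow> 'a::linorder) \<Rightarrow> 'a" where
  "kth_smallest k A z = sorted_list_of_multiset (image_mset z (mset_set A)) ! (k - 1)"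

lemma length_sorted_list_of_multiset [simp]: "length (sorted_list_of_multiset X) = size X"
  by (metis mset_sorted_list_of_multiset size_mset)

text \<open>Turns order statistics into counting. With \<open>1 \<le> k\<close>, the zero-based test
  \<open>k - 1 < c\<close> is \<open>k \<le> c\<close>.\<close>

lemma kth_smallest_le_iff:
  assumes "finite A" "1 \<le> k" "k \<le> card A"
  shows "kth_smallest k A z \<le> t \<longleftrightarrow> k \<le> card {a \<in> A. z a \<le> t}"
proof -
  let ?xs = "sorted_list_of_multiset (image_mset z (mset_set A))"
  have "length (filter (\<lambda>x. x \<le> t) ?xs) = size (filter_mset (\<lambda>x. x \<le> t) (image_mset z (mset_set A)))"
    by (metis mset_filter mset_sorted_list_of_multiset size_mset)
  also have "\<dots> = card {a \<in> A. z a \<le> t}"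
    using assms(1) by (simp add: filter_mset_image_mset)
  finally show ?thesis
    using sorted_nth_le_iff[of ?xs "k - 1" t] assms by (auto simp: kth_smallest_def)
qed

lemma kth_smallest_in_image:
  assumes "finite A" "1 \<le> k" "k \<le> card A"
  shows "kth_smallest k A z \<in> z ` A"
proof -
  let ?xs = "sorted_list_of_multiset (image_mset z (mset_set A))"
  have "?xs ! (k - 1) \<in> set ?xs"
    using assms by (intro nth_mem) simp
  then show ?thesis using assms by (simp add: kth_smallest_def)
qed

text \<open>By injectivity the count of values \<open>\<le> z l\<close> exceeds the count of values
  \<open>< z l\<close> by exactly one, namely \<open>l\<close> itself.\<close>

lemma kth_smallest_eq_iff:
  assumes "finite A" "1 \<le> k" "k \<le> card A" and inj: "inj_on z A" and "l \<in> A"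
  shows "kth_smallest k A z = z l \<longleftrightarrow> card {a \<in> A. z a < z l} = k - 1"
proof -
  have le: "{a \<in> A. z a \<le> z l} = insert l {a \<in> A. z a < z l}"
    using assms by (auto simp: inj_on_def order_le_less)
  have card_le: "card {a \<in> A. z a \<le> z l} = Suc (card {a \<in> A. z a < z l})"
    unfolding le using assms by simp
  note iff = kth_smallest_le_iff[OF assms(1-3), of z]
  show ?thesis
  proof
    assume eq: "kth_smallest k A z = z l"
    have "k \<le> Suc (card {a \<in> A. z a < z l})"
      using iff[of "z l"] eq card_le by simp
    \<comment> \<open>If \<open>k\<close> values were below \<open>z l\<close>, the largest of them,
      \<open>z m\<close>, would already bound the \<open>k\<close>-th smallest value.\<close>
    moreover have "\<not> k \<le> card {a \<in> A. z a < z l}"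
    proof
      assume k: "k \<le> card {a \<in> A. z a < z l}"
      define L where "L = {a \<in> A. z a < z l}"
      have "card L \<noteq> 0" using k assms(2) by (simp add: L_def)
      then have "L \<noteq> {}" "finite L" by (auto intro: card_ge_0_finite)
      then have "Max (z ` L) \<in> z ` L" by simp
      then obtain m where m: "m \<in> L" "z m = Max (z ` L)" by auto
      have "L \<subseteq> {a \<in> A. z a \<le> z m}"
        using \<open>finite L\<close> by (auto simp: L_def m(2) intro!: Max_ge)
      then have "card L \<le> card {a \<in> A. z a \<le> z m}"
        using assms(1) by (intro card_mono) auto
      then have "kth_smallest k A z \<le> z m" using k iff by (simp add: L_def)
      moreover have "z m < z l" using m(1) by (simp add: L_def)
      ultimately show False using eq by simp
    qed
    ultimately show "card {a \<in> A. z a < z l} = k - 1" by simp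
  next
    assume c: "card {a \<in> A. z a < z l} = k - 1"
    have "kth_smallest k A z \<le> z l"
      using iff[of "z l"] c card_le assms by simp
    moreover have "\<not> kth_smallest k A z < z l"
    proof
      let ?t = "kth_smallest k A z"
      assume t: "?t < z l"
      have "k \<le> card {a \<in> A. z a \<le> ?t}" using iff[of ?t] by simp
      also have "\<dots> \<le> card {a \<in> A. z a < z l}"
        using assms(1) t by (intro card_mono) auto
      finally show False using c assms by simp
    qed
    ultimately show "kth_smallest k A z = z l" by simp
  qed
qed

lemma kth_smallest_reindex:
  assumes "inj_on f A"
  shows "kth_smallest k (f ` A) z = kth_smallest k A (\<lambda>a. z (f a))"
  using assms by (simp add: kth_smallest_def image_mset_mset_set[symmetric] multiset.map_comp o_def)

lemma kth_smallest_cong: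
  "(\<And>a. a \<in> A \<Longrightarrow> z a = z' a) \<Longrightarrow> kth_smallest k A z = kth_smallest k A z'"
  unfolding kth_smallest_def
  by (metis (mono_tags, lifting) elem_mset_set image_mset_cong infinite_set_mset_mset_set empty_iff)

section \<open>Measurability of order statistics and of counts\<close>

lemma measurable_kth_smallest:
  fixes z :: "'a \<Rightarrow> 'i \<Rightarrow> real"
  assumes "finite A" "1 \<le> k" "k \<le> card A"
    and [measurable]: "\<And>a. a \<in> A \<Longrightarrow> (\<lambda>w. z w a) \<in> borel_measurable M"
  shows "(\<lambda>w. kth_smallest k A (z w)) \<in> borel_measurable M"
proof (subst borel_measurable_iff_le, rule allI)
  fix t
  have eq: "card {a \<in> A. z w a \<le> t} = (\<Sum>a\<in>A. if z w a \<le> t then 1 else 0)" for w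
    using assms(1) by (subst sum.inter_filter[symmetric]) auto
  show "{w \<in> space M. kth_smallest k A (z w) \<le> t} \<in> sets M"
    unfolding kth_smallest_le_iff[OF assms(1-3)] eq
    using assms(1) by measurable
qed

lemma measurable_count_le_kth_smallest:
  fixes z :: "'a \<Rightarrow> 'i \<Rightarrow> real" and G :: "nat \<Rightarrow> real"
  assumes fin: "finite A" "finite B" and k: "1 \<le> k" "k \<le> card A"
    and meas: "\<And>a. a \<in> A \<union> B \<Longrightarrow> (\<lambda>w. z w a) \<in> borel_measurable M"
  shows "(\<lambda>w. G (card {b \<in> B. z w b \<le> kth_smallest k A (z w)})) \<in> borel_measurable M"
proof -
  have [measurable]: "(\<lambda>w. z w b) \<in> borel_measurable M" if "b \<in> B" for b using that meas by auto
  have [measurable]: "(\<lambda>w. kth_smallest k A (z w)) \<in> borel_measurable M"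
    using fin k meas by (intro measurable_kth_smallest) auto
  \<comment> \<open>The count is recovered as the floor of a real sum of indicators. Its values are
    discrete, so composing with an arbitrary \<open>G\<close> stays measurable.\<close>
  have count: "card {b \<in> B. z w b \<le> kth_smallest k A (z w)} =
    nat \<lfloor>\<Sum>b\<in>B. if z w b \<le> kth_smallest k A (z w) then 1 else 0 :: real\<rfloor>" for w
    using fin by (subst sum.inter_filter[symmetric]) auto
  have "(\<lambda>w. \<Sum>b\<in>B. if z w b \<le> kth_smallest k A (z w) then 1 else 0 :: real) \<in> borel_measurable M"
    by (intro borel_measurable_sum) measurable
  then show ?thesis
    unfolding count by (intro measurable_compose[OF measurable_compose[OF _ measurable_real_floor]]) auto
qed

text \<open>Ties with \<open>l\<close> count as larger, so that the integrals below involve only \<open>\<mu> {..<t}\<close>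
  and its complement.\<close>

definition rank_event :: "'i set \<Rightarrow> 'i \<Rightarrow> 'i set \<Rightarrow> ('i \<Rightarrow> real) \<Rightarrow> real" where
  "rank_event J l S z =
    (\<Prod>a\<in>J - {l}. if a \<in> S then indicator {..<z l} (z a) else indicator {z l..} (z a))"

text \<open>Each factor tests one element, so the product is an indicator. The product form is what
  independence later factorizes.\<close>

lemma rank_event_eq:
  assumes "finite J" "S \<subseteq> J - {l}"
  shows "rank_event J l S z = of_bool (S = {a \<in> J - {l}. z a < z l})"
proof -
  have "rank_event J l S z = (\<Prod>a\<in>J - {l}. of_bool (a \<in> S \<longleftrightarrow> z a < z l))"
    unfolding rank_event_def by (intro prod.cong) (auto simp: indicator_def)
  also have "\<dots> = of_bool (\<forall>a\<in>J - {l}. a \<in> S \<longleftrightarrow> z a < z l)"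
    using assms by (auto intro!: prod_zero)
  also have "(\<forall>a\<in>J - {l}. a \<in> S \<longleftrightarrow> z a < z l) \<longleftrightarrow> S = {a \<in> J - {l}. z a < z l}"
    using assms by auto
  finally show ?thesis .
qed

text \<open>Without ties exactly one triple \<open>(l, K, T)\<close> contributes: \<open>l\<close>
  attains the \<open>k\<close>-th smallest value, and \<open>K\<close> and \<open>T\<close> are the
  elements of \<open>A\<close> and \<open>B\<close> below it.\<close>

lemma count_le_kth_smallest_decomp:
  fixes G :: "nat \<Rightarrow> real"
  assumes fin: "finite A" "finite B" and disj: "A \<inter> B = {}"
    and k: "1 \<le> k" "k \<le> card A" and inj: "inj_on z (A \<union> B)"
  shows "G (card {b \<in> B. z b \<le> kth_smallest k A z}) =
    (\<Sum>l\<in>A. \<Sum>K | K \<subseteq> A - {l} \<and> card K = k - 1. \<Sum>T\<in>Pow B.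
      G (card T) * rank_event (A \<union> B) l (K \<union> T) z)"
proof -
  have injA: "inj_on z A" using inj by (auto simp: inj_on_def)
  obtain m where m: "m \<in> A" "kth_smallest k A z = z m"
    using kth_smallest_in_image[OF fin(1) k] by auto
  \<comment> \<open>The closed ball gives \<open>\<le>\<close>, rank events give \<open><\<close>;
    they agree since no element of \<open>B\<close> ties with \<open>m\<close>.\<close>
  have B: "{b \<in> B. z b \<le> z m} = {b \<in> B. z b < z m}"
    using inj m disj by (auto simp: inj_on_def order_le_less)
  have inner: "(\<Sum>K | K \<subseteq> A - {l} \<and> card K = k - 1. \<Sum>T\<in>Pow B.
      G (card T) * rank_event (A \<union> B) l (K \<union> T) z) =
      (if l = m then G (card {b \<in> B. z b < z l}) else 0)" if l: "l \<in> A" for l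
  proof -
    let ?K = "{a \<in> A. z a < z l}" and ?T = "{b \<in> B. z b < z l}"
    have "rank_event (A \<union> B) l (K \<union> T) z = of_bool (K = ?K) * of_bool (T = ?T)"
      if "K \<subseteq> A - {l}" "T \<subseteq> B" for K T
    proof -
      have "K \<union> T \<subseteq> A \<union> B - {l}" using that disj l by auto
      moreover have "K \<union> T = {a \<in> A \<union> B - {l}. z a < z l} \<longleftrightarrow> K = ?K \<and> T = ?T"
        using that disj l by blast
      ultimately show ?thesis using fin by (subst rank_event_eq) (auto simp del: of_bool_eq_iff)
    qed
    then have "(\<Sum>K | K \<subseteq> A - {l} \<and> card K = k - 1. \<Sum>T\<in>Pow B.
      G (card T) * rank_event (A \<union> B) l (K \<union> T) z) =
      (\<Sum>K | K \<subseteq> A - {l} \<and> card K = k - 1. \<Sum>T\<in>Pow B.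
        if T = ?T then G (card T) * of_bool (K = ?K) else 0)"
      by (intro sum.cong refl) auto
    also have "\<dots> = (\<Sum>K | K \<subseteq> A - {l} \<and> card K = k - 1. if K = ?K then G (card ?T) else 0)"
      using fin by (intro sum.cong refl, subst sum.delta) auto
    also have "\<dots> = (if card ?K = k - 1 then G (card ?T) else 0)"
      using fin by (subst sum.delta) auto
    \<comment> \<open>The size constraint on \<open>K\<close> is what singles out
      \<open>l = m\<close>.\<close>
    also have "card ?K = k - 1 \<longleftrightarrow> l = m"
      using kth_smallest_eq_iff[OF fin(1) k injA l] m l injA by (auto simp: inj_on_def)
    finally show ?thesis by simp
  qed
  have "(\<Sum>l\<in>A. if l = m then G (card {b \<in> B. z b < z l}) else 0) = G (card {b \<in> B. z b < z m})"
    using fin m by simp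
  then show ?thesis using inner B m by simp
qed

text \<open>Fubini with coordinate \<open>i\<close> outermost, i.e. conditioning on its value. It is
  applied to the centre of the ball and to the neighbour \<open>l\<close>.\<close>

lemma (in product_sigma_finite) product_integral_insert_rev:
  fixes f :: "_ \<Rightarrow> _::{banach, second_countable_topology}"
  assumes I: "finite I" "i \<notin> I" and f: "integrable (Pi\<^sub>M (insert i I) M) f"
  shows "integral\<^sup>L (Pi\<^sub>M (insert i I) M) f = (\<integral>y. (\<integral>x. f (x(i := y)) \<partial>Pi\<^sub>M I M) \<partial>M i)"
proof -
  interpret I: finite_product_sigma_finite M I by standard fact
  have [measurable]: "f \<in> borel_measurable (Pi\<^sub>M (insert i I) M)" using f by auto
  have meas: "(\<lambda>y. \<integral>x. f (x(i := y)) \<partial>Pi\<^sub>M I M) \<in> borel_measurable (M i)"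
    by measurable
  have "integral\<^sup>L (Pi\<^sub>M (insert i I) M) f = integral\<^sup>L (Pi\<^sub>M ({i} \<union> I) M) f"
    by simp
  also have "\<dots> = (\<integral>y. (\<integral>x. f (merge {i} I (y, x)) \<partial>Pi\<^sub>M I M) \<partial>Pi\<^sub>M {i} M)"
    using f I by (intro product_integral_fold) auto
  \<comment> \<open>Merging is a function update here because points of the product space are
    extensional on \<open>I\<close>.\<close>
  also have "\<dots> = (\<integral>y. (\<integral>x. f (x(i := y i)) \<partial>Pi\<^sub>M I M) \<partial>Pi\<^sub>M {i} M)"
    using I by (intro Bochner_Integration.integral_cong refl arg_cong[where f = f])
      (auto simp: merge_def space_PiM extensional_def PiE_def fun_eq_iff)
  also have "\<dots> = (\<integral>y. (\<integral>x. f (x(i := y)) \<partial>Pi\<^sub>M I M) \<partial>M i)"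
    by (rule product_integral_singleton[OF meas])
  finally show ?thesis .
qed

subsection \<open>Rank events of independent samples\<close>

lemma Beta_nat: "Beta (real (Suc s)) (real (Suc r)) = fact s * fact r / fact (s + r + 1)"
proof -
  have "real (Suc s) = 1 + real s" "real (Suc r) = 1 + real r"
    "real (Suc s) + real (Suc r) = 1 + real (s + r + 1)"
    by simp_all
  then show ?thesis unfolding Beta_def by (simp only: Gamma_fact)
qed

text \<open>With \<open>k = s + 1\<close> and \<open>n = s + r + 1\<close>, the count is
  \<open>n! / (s! r!)\<close>, the reciprocal of the value in \<open>Beta_nat\<close>. It is the
  number of pairs \<open>(l, K)\<close> in an \<open>n\<close>-element set.\<close>

lemma Beta_binomial:
  assumes "1 \<le> k" "k \<le> n"
  shows "real (n * (n - 1 choose (k - 1))) * Beta (real k) (real (n - k + 1)) = 1"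
proof -
  obtain s where s: "k = Suc s" using assms by (cases k) auto
  obtain r where r: "n = Suc (s + r)" using assms s by (metis le_Suc_ex add_Suc)
  have "real (fact s * fact r * (s + r choose s)) = real (fact (s + r))"
    using binomial_fact_lemma[of s "s + r"] by simp
  then have "real (s + r choose s) = fact (s + r) / (fact s * fact r)"
    by (simp add: nonzero_eq_divide_eq mult_ac)
  moreover have "fact (s + r + 1) = real (Suc (s + r)) * fact (s + r)" by simp
  moreover have "k - 1 = s" "n - 1 = s + r" "n - k + 1 = Suc r" using s r by auto
  ultimately show ?thesis
    using s r by (simp only: Beta_nat of_nat_mult) simp
qed

text \<open>Models the law of the distance to a fixed centre; the absence of atoms corresponds to
  spheres around that centre being null.\<close>

locale atomless_real_distribution = real_distribution \<mu> for \<mu> :: "real measure" +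
  assumes atomless: "\<And>t. measure \<mu> {t} = 0"
begin

sublocale fin_prod: product_prob_space "\<lambda>_. \<mu>" ..

lemma measurable_PiM_component:
  "a \<in> J \<Longrightarrow> (\<lambda>z. z a) \<in> borel_measurable (Pi\<^sub>M J (\<lambda>_. \<mu>))"
  using measurable_component_singleton[of a J "\<lambda>_. \<mu>"] by (simp cong: measurable_cong_sets)

lemma prob_space_PiM_const: "prob_space (Pi\<^sub>M J (\<lambda>_. \<mu>))"
  by (rule prob_space_PiM) (rule prob_space_axioms)

text \<open>Once the other coordinates are fixed, a tie forces \<open>z a\<close> into the single
  point \<open>z b\<close>, which has mass zero.\<close>

lemma AE_components_distinct:
  assumes "finite J" "a \<in> J" "b \<in> J" "a \<noteq> b"
  shows "AE z in Pi\<^sub>M J (\<lambda>_. \<mu>). z a \<noteq> z b"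
proof -
  define J' where "J' = J - {a}"
  have J: "J = insert a J'" and J': "finite J'" "a \<notin> J'" "b \<in> J'" using assms by (auto simp: J'_def)
  have meas: "(\<lambda>z. indicator {z b} (z a) :: ennreal) \<in> borel_measurable (Pi\<^sub>M J (\<lambda>_. \<mu>))"
  proof -
    have "(\<lambda>z. z a - z b) \<in> borel_measurable (Pi\<^sub>M J (\<lambda>_. \<mu>))"
      using assms by (intro borel_measurable_diff measurable_PiM_component)
    then have "(\<lambda>z. indicator {0} (z a - z b) :: ennreal) \<in> borel_measurable (Pi\<^sub>M J (\<lambda>_. \<mu>))"
      by (rule measurable_compose) simp
    then show ?thesis by (simp add: indicator_def)
  qed
  have atom: "(\<integral>\<^sup>+ y. indicator {t} y \<partial>\<mu>) = 0" for t
    using atomless[of t] by (simp add: emeasure_eq_measure)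
  have "(\<integral>\<^sup>+ z. indicator {z b} (z a) \<partial>Pi\<^sub>M J (\<lambda>_. \<mu>)) =
      (\<integral>\<^sup>+ x. \<integral>\<^sup>+ y. indicator {(x(a := y)) b} ((x(a := y)) a) \<partial>\<mu> \<partial>Pi\<^sub>M J' (\<lambda>_. \<mu>))"
    unfolding J by (rule fin_prod.product_nn_integral_insert[OF J'(1,2) meas[unfolded J]])
  also have "\<dots> = 0" using assms(4) by (simp add: atom del: nn_integral_indicator)
  finally have "(\<integral>\<^sup>+ z. indicator {z b} (z a) \<partial>Pi\<^sub>M J (\<lambda>_. \<mu>)) = 0" .
  then have "AE z in Pi\<^sub>M J (\<lambda>_. \<mu>). indicator {z b} (z a) = (0 :: ennreal)"
    using nn_integral_0_iff_AE[OF meas] by simp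
  then show ?thesis by eventually_elim auto
qed

lemma AE_inj_on:
  assumes "finite J"
  shows "AE z in Pi\<^sub>M J (\<lambda>_. \<mu>). inj_on z J"
proof -
  have "AE z in Pi\<^sub>M J (\<lambda>_. \<mu>). \<forall>a\<in>J. \<forall>b\<in>J. a \<noteq> b \<longrightarrow> z a \<noteq> z b"
    by (intro AE_finite_allI AE_impI AE_components_distinct assms)
  then show ?thesis by eventually_elim (auto simp: inj_on_def)
qed

text \<open>The probability that a given sample has a prescribed set of \<open>s\<close> samples
  below it and \<open>r\<close> prescribed others not below it, after conditioning on its value
  \<open>t\<close>.\<close>

definition rank_prob :: "nat \<Rightarrow> nat \<Rightarrow> real" where
  "rank_prob s r = (\<integral>t. measure \<mu> {..<t} ^ s * (1 - measure \<mu> {..<t}) ^ r \<partial>\<mu>)"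

section \<open>Integrals of rank events\<close>

lemma measurable_rank_event:
  assumes "finite J" "l \<in> J"
  shows "rank_event J l S \<in> borel_measurable (Pi\<^sub>M J (\<lambda>_. \<mu>))"
  unfolding rank_event_def[abs_def]
proof (rule borel_measurable_prod)
  fix a assume a: "a \<in> J - {l}"
  \<comment> \<open>The half-line \<open>{..<z l}\<close> moves with \<open>z\<close>; passing to
    the difference replaces it by a fixed one.\<close>
  have diff: "(\<lambda>z. z a - z l) \<in> borel_measurable (Pi\<^sub>M J (\<lambda>_. \<mu>))"
    using assms a by (intro borel_measurable_diff measurable_PiM_component) auto
  have "(\<lambda>z. indicator {..<0} (z a - z l) :: real) \<in> borel_measurable (Pi\<^sub>M J (\<lambda>_. \<mu>))"
    "(\<lambda>z. indicator {0..} (z a - z l) :: real) \<in> borel_measurable (Pi\<^sub>M J (\<lambda>_. \<mu>))"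
    by (rule measurable_compose[OF diff], simp)+
  then show "(\<lambda>z. if a \<in> S then indicator {..<z l} (z a) else indicator {z l..} (z a) :: real)
      \<in> borel_measurable (Pi\<^sub>M J (\<lambda>_. \<mu>))"
    by (cases "a \<in> S") (simp_all add: indicator_def)
qed

lemma rank_event_bounds: "0 \<le> rank_event J l S z" "rank_event J l S z \<le> 1"
  unfolding rank_event_def by (rule prod_nonneg, simp, rule prod_le_1, simp)

lemma integrable_rank_event:
  assumes "finite J" "l \<in> J"
  shows "integrable (Pi\<^sub>M J (\<lambda>_. \<mu>)) (rank_event J l S)"
proof -
  interpret PJ: prob_space "Pi\<^sub>M J (\<lambda>_. \<mu>)" by (rule prob_space_PiM_const)
  show ?thesis
    using assms by (intro PJ.integrable_const_bound[where B = 1]) (auto simp: rank_event_bounds measurable_rank_event)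
qed

text \<open>Given \<open>z l = t\<close> the other coordinates are independent: each one in
  \<open>S\<close> contributes the mass of \<open>{..<t}\<close>, each other one the complementary
  mass.\<close>

lemma integral_rank_event:
  assumes "finite J" "l \<in> J" "S \<subseteq> J - {l}"
  shows "(\<integral>z. rank_event J l S z \<partial>Pi\<^sub>M J (\<lambda>_. \<mu>)) = rank_prob (card S) (card J - 1 - card S)"
proof -
  let ?J = "J - {l}"
  let ?f = "\<lambda>t a x. if a \<in> S then indicator {..<t} x else indicator {t..} x :: real"
  have ge: "measure \<mu> {t..} = 1 - measure \<mu> {..<t}" for t
  proof -
    have "{t..} = space \<mu> - {..<t}" by auto
    then show ?thesis using prob_compl[of "{..<t}"] by simp
  qed
  have fint: "integrable \<mu> (?f t a)" for t a
    by (cases "a \<in> S") (auto intro!: integrable_real_indicator simp: emeasure_eq_measure)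
  have "(\<integral>z. rank_event J l S z \<partial>Pi\<^sub>M J (\<lambda>_. \<mu>)) =
      (\<integral>t. (\<integral>z. rank_event J l S (z(l := t)) \<partial>Pi\<^sub>M ?J (\<lambda>_. \<mu>)) \<partial>\<mu>)"
    using fin_prod.product_integral_insert_rev[of ?J l "rank_event J l S"] integrable_rank_event[OF assms(1,2)]
      assms(1,2) by (simp add: insert_absorb)
  also have "\<dots> = (\<integral>t. measure \<mu> {..<t} ^ card S * (1 - measure \<mu> {..<t}) ^ (card J - 1 - card S) \<partial>\<mu>)"
  proof (intro Bochner_Integration.integral_cong refl)
    fix t
    have "(\<integral>z. rank_event J l S (z(l := t)) \<partial>Pi\<^sub>M ?J (\<lambda>_. \<mu>)) =
        (\<integral>z. (\<Prod>a\<in>?J. ?f t a (z a)) \<partial>Pi\<^sub>M ?J (\<lambda>_. \<mu>))"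
      unfolding rank_event_def by (intro Bochner_Integration.integral_cong prod.cong refl) auto
    also have "\<dots> = (\<Prod>a\<in>?J. integral\<^sup>L \<mu> (?f t a))"
      using assms fint by (intro fin_prod.product_integral_prod) auto
    also have "\<dots> = (\<Prod>a\<in>?J. if a \<in> S then measure \<mu> {..<t} else 1 - measure \<mu> {..<t})"
      by (intro prod.cong refl) (auto simp: ge)
    also have "\<dots> = measure \<mu> {..<t} ^ card (?J \<inter> S) * (1 - measure \<mu> {..<t}) ^ card (?J \<inter> - S)"
      using assms by (subst prod.If_cases) auto
    also have "?J \<inter> S = S" using assms by auto
    also have "card (?J \<inter> - S) = card J - 1 - card S"
      using assms by (simp add: Diff_eq[symmetric] card_Diff_subset finite_subset)
    finally show "(\<integral>z. rank_event J l S (z(l := t)) \<partial>Pi\<^sub>M ?J (\<lambda>_. \<mu>)) =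
      measure \<mu> {..<t} ^ card S * (1 - measure \<mu> {..<t}) ^ (card J - 1 - card S)" .
  qed
  finally show ?thesis by (simp add: rank_prob_def)
qed

text \<open>Integrating the decomposition termwise leaves a value depending only on
  \<open>card T\<close>. There are \<open>card A\<close> choices of \<open>l\<close>, then
  binomially many of \<open>K\<close> and of \<open>T\<close> with
  \<open>card T = j\<close>.\<close>

lemma integral_count_le_kth_smallest_rank_prob:
  fixes G :: "nat \<Rightarrow> real"
  assumes fin: "finite A" "finite B" and disj: "A \<inter> B = {}"
    and k: "1 \<le> k" "k \<le> card A"
  shows "(\<integral>z. G (card {b \<in> B. z b \<le> kth_smallest k A z}) \<partial>Pi\<^sub>M (A \<union> B) (\<lambda>_. \<mu>)) =
    real (card A * (card A - 1 choose (k - 1))) *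
      (\<Sum>j = 0..card B. G j * real (card B choose j) *
        rank_prob (k - 1 + j) (card A - k + card B - j))"
proof -
  let ?\<Omega> = "Pi\<^sub>M (A \<union> B) (\<lambda>_. \<mu>)"
  let ?KS = "\<lambda>l. {K. K \<subseteq> A - {l} \<and> card K = k - 1}"
  let ?p = "\<lambda>j. G j * rank_prob (k - 1 + j) (card A - k + card B - j)"
  have meas: "(\<lambda>z. G (card {b \<in> B. z b \<le> kth_smallest k A z})) \<in> borel_measurable ?\<Omega>"
    by (intro measurable_count_le_kth_smallest fin k measurable_PiM_component)
  have "(\<integral>z. G (card {b \<in> B. z b \<le> kth_smallest k A z}) \<partial>?\<Omega>) =
    (\<integral>z. (\<Sum>l\<in>A. \<Sum>K\<in>?KS l. \<Sum>T\<in>Pow B.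
      G (card T) * rank_event (A \<union> B) l (K \<union> T) z) \<partial>?\<Omega>)"
  proof (rule integral_cong_AE[OF meas])
    show "(\<lambda>z. \<Sum>l\<in>A. \<Sum>K\<in>?KS l. \<Sum>T\<in>Pow B. G (card T) * rank_event (A \<union> B) l (K \<union> T) z)
      \<in> borel_measurable ?\<Omega>"
      using fin by (intro borel_measurable_sum borel_measurable_times measurable_rank_event) auto
    show "AE z in ?\<Omega>. G (card {b \<in> B. z b \<le> kth_smallest k A z}) =
      (\<Sum>l\<in>A. \<Sum>K\<in>?KS l. \<Sum>T\<in>Pow B. G (card T) * rank_event (A \<union> B) l (K \<union> T) z)"
      \<comment> \<open>The decomposition requires distinct values, which hold almost
        surely.\<close>
      using AE_inj_on[OF finite_UnI[OF fin]]
      by (rule eventually_mono) (rule count_le_kth_smallest_decomp[OF fin disj k])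
  qed
  also have "\<dots> = (\<Sum>l\<in>A. \<Sum>K\<in>?KS l. \<Sum>T\<in>Pow B.
      G (card T) * (\<integral>z. rank_event (A \<union> B) l (K \<union> T) z \<partial>?\<Omega>))"
  proof -
    have int: "integrable ?\<Omega> (\<lambda>z. G (card T) * rank_event (A \<union> B) l (K \<union> T) z)" if "l \<in> A" for l K T
      using that fin by (intro integrable_mult_right integrable_rank_event) auto
    have "(\<integral>z. (\<Sum>l\<in>A. \<Sum>K\<in>?KS l. \<Sum>T\<in>Pow B. G (card T) * rank_event (A \<union> B) l (K \<union> T) z) \<partial>?\<Omega>)
      = (\<Sum>l\<in>A. \<integral>z. (\<Sum>K\<in>?KS l. \<Sum>T\<in>Pow B. G (card T) * rank_event (A \<union> B) l (K \<union> T) z) \<partial>?\<Omega>)"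
      by (intro Bochner_Integration.integral_sum Bochner_Integration.integrable_sum int)
    also have "\<dots> = (\<Sum>l\<in>A. \<Sum>K\<in>?KS l. \<integral>z. (\<Sum>T\<in>Pow B. G (card T) * rank_event (A \<union> B) l (K \<union> T) z) \<partial>?\<Omega>)"
      by (intro sum.cong refl Bochner_Integration.integral_sum Bochner_Integration.integrable_sum int)
    also have "\<dots> = (\<Sum>l\<in>A. \<Sum>K\<in>?KS l. \<Sum>T\<in>Pow B. \<integral>z. G (card T) * rank_event (A \<union> B) l (K \<union> T) z \<partial>?\<Omega>)"
      by (intro sum.cong refl Bochner_Integration.integral_sum int)
    finally show ?thesis by (simp only: integral_mult_right_zero)
  qed
  also have "\<dots> = (\<Sum>l\<in>A. \<Sum>K\<in>?KS l. \<Sum>T\<in>Pow B. ?p (card T))"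
  proof (intro sum.cong refl)
    fix l K T assume l: "l \<in> A" and K: "K \<in> ?KS l" and T: "T \<in> Pow B"
    have "finite K" "finite T" "K \<inter> T = {}" using K T fin disj by (auto intro: finite_subset)
    then have c: "card (K \<union> T) = k - 1 + card T" using K by (simp add: card_Un_disjoint)
    \<comment> \<open>This and \<open>k \<le> card A\<close> make the natural-number subtractions
      below exact.\<close>
    have "card T \<le> card B" using T fin by (auto intro: card_mono)
    then have "card (A \<union> B) - 1 - card (K \<union> T) = card A - k + card B - card T"
      using k fin disj c by (simp add: card_Un_disjoint)
    moreover have "K \<union> T \<subseteq> A \<union> B - {l}" using K T l disj by auto
    ultimately show "G (card T) * (\<integral>z. rank_event (A \<union> B) l (K \<union> T) z \<partial>?\<Omega>) = ?p (card T)"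
      using fin l c by (subst integral_rank_event) auto
  qed
  also have "\<dots> = (\<Sum>l\<in>A. \<Sum>K\<in>?KS l. \<Sum>j = 0..card B. real (card B choose j) * ?p j)"
  proof (intro sum.cong refl)
    have "(\<Sum>T\<in>Pow B. ?p (card T)) = (\<Sum>j\<in>{0..card B}. \<Sum>T\<in>{T \<in> Pow B. card T = j}. ?p (card T))"
      using fin by (intro sum.group[symmetric]) (auto intro: card_mono)
    also have "\<dots> = (\<Sum>j = 0..card B. real (card B choose j) * ?p j)"
      using fin by (intro sum.cong refl) (simp add: n_subsets)
    finally show "(\<Sum>T\<in>Pow B. ?p (card T)) = (\<Sum>j = 0..card B. real (card B choose j) * ?p j)" .
  qed
  also have "\<dots> = real (card A * (card A - 1 choose (k - 1))) *
      (\<Sum>j = 0..card B. real (card B choose j) * ?p j)"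
    using fin by (simp add: n_subsets)
  finally show ?thesis by (simp add: mult_ac)
qed

text \<open>For an empty second sample and the weight \<open>G = 1\<close> the counting identity above has left-hand side 1,
  which evaluates the integral without computing it.\<close>

lemma rank_prob_eq_Beta: "rank_prob s r = Beta (real (s + 1)) (real (r + 1))"
proof -
  interpret P: prob_space "Pi\<^sub>M {..s + r} (\<lambda>_. \<mu>)" by (rule prob_space_PiM_const)
  have "1 = real (card {..s + r} * (card {..s + r} - 1 choose s)) * rank_prob s r"
    using integral_count_le_kth_smallest_rank_prob[of "{..s + r}" "{}" "Suc s" "\<lambda>_. 1"]
    by (simp add: P.prob_space)
  moreover have "1 = real (card {..s + r} * (card {..s + r} - 1 choose s)) * Beta (real (s + 1)) (real (r + 1))"
    using Beta_binomial[of "s + 1" "s + r + 1"] by (simp add: add_ac)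
  \<comment> \<open>The common factor can be cancelled: a product containing it equals 1, so it is
    nonzero.\<close>
  ultimately show ?thesis by (metis mult_cancel_left mult_zero_left zero_neq_one)
qed

text \<open>By \<open>Beta_binomial\<close> the number of pairs \<open>(l, K)\<close> is the
  reciprocal of the Beta value in the denominator.\<close>

lemma integral_count_le_kth_smallest:
  fixes G :: "nat \<Rightarrow> real"
  assumes fin: "finite A" "finite B" and disj: "A \<inter> B = {}"
    and k: "1 \<le> k" "k \<le> card A"
  shows "(\<integral>z. G (card {b \<in> B. z b \<le> kth_smallest k A z}) \<partial>Pi\<^sub>M (A \<union> B) (\<lambda>_. \<mu>)) =
    (\<Sum>j = 0..card B. G j * real (card B choose j) *
      (Beta (real (k + j)) (real (card A - k + 1 + card B - j)) / Beta (real k) (real (card A - k + 1))))"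
proof -
  let ?c = "real (card A * (card A - 1 choose (k - 1)))" and ?\<beta> = "Beta (real k) (real (card A - k + 1))"
  have c: "?c = 1 / ?\<beta>"
    using Beta_binomial[OF k] by (metis mult_zero_right nonzero_eq_divide_eq zero_neq_one)
  have "(\<integral>z. G (card {b \<in> B. z b \<le> kth_smallest k A z}) \<partial>Pi\<^sub>M (A \<union> B) (\<lambda>_. \<mu>)) =
    (\<Sum>j = 0..card B. 1 / ?\<beta> * (G j * real (card B choose j) *
        rank_prob (k - 1 + j) (card A - k + card B - j)))"
    unfolding integral_count_le_kth_smallest_rank_prob[OF assms] c sum_distrib_left ..
  also have "\<dots> = (\<Sum>j = 0..card B. G j * real (card B choose j) *
      (Beta (real (k + j)) (real (card A - k + 1 + card B - j)) / ?\<beta>))"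
  proof (intro sum.cong refl)
    fix j assume "j \<in> {0..card B}"
    then have "k - 1 + j + 1 = k + j" "card A - k + card B - j + 1 = card A - k + 1 + card B - j"
      using k by auto
    then show "1 / ?\<beta> * (G j * real (card B choose j) *
        rank_prob (k - 1 + j) (card A - k + card B - j)) = G j * real (card B choose j) *
      (Beta (real (k + j)) (real (card A - k + 1 + card B - j)) / ?\<beta>)"
      unfolding rank_prob_eq_Beta by simp
  qed
  finally show ?thesis .
qed

end

subsection \<open>Coverage of identically distributed samples\<close>

text \<open>For almost every centre \<open>x\<close> the distances to the other points are i.i.d.
  with an atomless law, and the conditional expectation is the same for all these \<open>x\<close>.
  The bound on \<open>G\<close> gives integrability.\<close>

lemma integral_coverage_count:
  fixes D :: "'e::{metric_space, second_countable_topology} measure" and i :: 'i and G :: "nat \<Rightarrow> real"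
  assumes D: "prob_space D" "sets D = sets borel"
    and no_ties: "AE x in D. \<forall>r. measure D (sphere x r) = 0"
    and fin: "finite A" "finite B" and disj: "A \<inter> B = {}" "i \<notin> A \<union> B"
    and k: "1 \<le> k" "k \<le> card A"
    and bounded: "\<And>n. \<bar>G n\<bar> \<le> C"
  defines "f \<equiv> \<lambda>w. G (card {b \<in> B. dist (w i) (w b) \<le> kth_smallest k A (\<lambda>a. dist (w i) (w a))})"
  shows "integrable (Pi\<^sub>M (insert i (A \<union> B)) (\<lambda>_. D)) f"
    and "integral\<^sup>L (Pi\<^sub>M (insert i (A \<union> B)) (\<lambda>_. D)) f =
    (\<Sum>j = 0..card B. G j * real (card B choose j) *
      (Beta (real (k + j)) (real (card A - k + 1 + card B - j)) / Beta (real k) (real (card A - k + 1))))"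
    (is "_ = ?c")
proof -
  interpret D: prob_space D by fact
  interpret PD: product_prob_space "\<lambda>_ :: 'i. D" ..
  let ?J = "A \<union> B"
  interpret PI: prob_space "Pi\<^sub>M (insert i ?J) (\<lambda>_. D)" by (rule prob_space_PiM) (rule D)
  have comp: "(\<lambda>w. w a) \<in> measurable (Pi\<^sub>M (insert i ?J) (\<lambda>_. D)) borel" if "a \<in> insert i ?J" for a
    using measurable_component_singleton[OF that, of "\<lambda>_. D"] D(2)
    by (simp cong: measurable_cong_sets)
  have "f \<in> borel_measurable (Pi\<^sub>M (insert i ?J) (\<lambda>_. D))"
    unfolding f_def by (intro measurable_count_le_kth_smallest borel_measurable_dist comp fin k) auto
  then show int: "integrable (Pi\<^sub>M (insert i ?J) (\<lambda>_. D)) f"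
    using bounded by (intro PI.integrable_const_bound[where B = C]) (auto simp: f_def)
  have inner: "(\<integral>z. f (z(i := x)) \<partial>Pi\<^sub>M ?J (\<lambda>_. D)) = ?c"
    if x: "\<forall>r. measure D (sphere x r) = 0" for x
  proof -
    define \<mu> where "\<mu> = distr D borel (dist x)"
    have dist_meas: "dist x \<in> measurable D borel"
      using D(2) by (simp cong: measurable_cong_sets)
    \<comment> \<open>Atoms of the distance law are exactly the spheres around \<open>x\<close> of
      positive mass.\<close>
    have "dist x -` {r} \<inter> space D = sphere x r" for r
      using sets_eq_imp_space_eq[OF D(2)] by auto
    then have "measure \<mu> {r} = 0" for r
      using x dist_meas by (simp add: \<mu>_def measure_distr)
    moreover have "prob_space \<mu>" unfolding \<mu>_def by (rule D.prob_space_distr[OF dist_meas])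
    ultimately interpret \<mu>: atomless_real_distribution \<mu>
      unfolding atomless_real_distribution_def atomless_real_distribution_axioms_def
        real_distribution_def real_distribution_axioms_def by (auto simp: \<mu>_def)
    let ?g = "\<lambda>z. G (card {b \<in> B. z b \<le> kth_smallest k A z})"
    \<comment> \<open>Applying \<open>dist x\<close> coordinatewise preserves independence;
      \<open>compose ?J\<close> keeps the result extensional.\<close>
    have law: "distr (Pi\<^sub>M ?J (\<lambda>_. D)) (Pi\<^sub>M ?J (\<lambda>_. \<mu>)) (compose ?J (dist x)) = Pi\<^sub>M ?J (\<lambda>_. \<mu>)"
      using distr_PiM_finite_prob_space'[of ?J "\<lambda>_. D" "\<lambda>_. \<mu>" "dist x"] fin D(1) \<mu>.prob_space_axioms dist_meas
      by (simp add: \<mu>_def cong: distr_cong)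
    have comp_meas: "compose ?J (dist x) \<in> measurable (Pi\<^sub>M ?J (\<lambda>_. D)) (Pi\<^sub>M ?J (\<lambda>_. \<mu>))"
      unfolding compose_def \<mu>_def
      by (intro measurable_restrict measurable_compose[OF measurable_component_singleton]) (auto simp: dist_meas)
    \<comment> \<open>Since \<open>i\<close> lies outside \<open>?J\<close>, setting coordinate
      \<open>i\<close> changes only the centre.\<close>
    have "f (z(i := x)) = ?g (compose ?J (dist x) z)" for z
    proof -
      have "kth_smallest k A (compose ?J (dist x) z) = kth_smallest k A (\<lambda>a. dist x ((z(i := x)) a))"
        using disj by (intro kth_smallest_cong) (auto simp: compose_def)
      moreover have "{b \<in> B. compose ?J (dist x) z b \<le> t} = {b \<in> B. dist x ((z(i := x)) b) \<le> t}" for t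
        using disj by (auto simp: compose_def)
      ultimately show ?thesis by (simp add: f_def)
    qed
    then have "(\<integral>z. f (z(i := x)) \<partial>Pi\<^sub>M ?J (\<lambda>_. D)) =
        (\<integral>z. ?g (compose ?J (dist x) z) \<partial>Pi\<^sub>M ?J (\<lambda>_. D))" by simp
    also have "\<dots> = integral\<^sup>L (distr (Pi\<^sub>M ?J (\<lambda>_. D)) (Pi\<^sub>M ?J (\<lambda>_. \<mu>)) (compose ?J (dist x))) ?g"
      by (intro integral_distr[symmetric] comp_meas measurable_count_le_kth_smallest
          \<mu>.measurable_PiM_component fin k)
    also have "\<dots> = ?c"
      unfolding law by (rule \<mu>.integral_count_le_kth_smallest[OF fin disj(1) k])
    finally show ?thesis .
  qed
  have "integral\<^sup>L (Pi\<^sub>M (insert i ?J) (\<lambda>_. D)) f = (\<integral>x. (\<integral>z. f (z(i := x)) \<partial>Pi\<^sub>M ?J (\<lambda>_. D)) \<partial>D)"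
    using fin disj by (intro PD.product_integral_insert_rev int) auto
  also have "\<dots> = (\<integral>x. ?c \<partial>D)"
  proof (rule integral_cong_AE)
    interpret PJ: finite_product_sigma_finite "\<lambda>_. D" ?J by standard (use fin in auto)
    have [measurable]: "f \<in> borel_measurable (Pi\<^sub>M (insert i ?J) (\<lambda>_. D))" using int by auto
    show "(\<lambda>x. \<integral>z. f (z(i := x)) \<partial>Pi\<^sub>M ?J (\<lambda>_. D)) \<in> borel_measurable D" by measurable
    show "AE x in D. (\<integral>z. f (z(i := x)) \<partial>Pi\<^sub>M ?J (\<lambda>_. D)) = ?c"
      using no_ties by eventually_elim (rule inner)
  qed simp
  also have "\<dots> = ?c" by (simp add: D.prob_space)
  finally show "integral\<^sup>L (Pi\<^sub>M (insert i ?J) (\<lambda>_. D)) f = ?c" .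
qed

text \<open>Both samples become one family on a sum type, so that they can be treated as coordinates
  of a single product space.\<close>

lemma clipped_coverage_unnorm_eq_sum_count:
  "clipped_coverage_unnorm k N M (\<lambda>l. w (Inl l)) (\<lambda>j. w (Inr j)) =
    1 / real N * (\<Sum>i = 1..N. min (real (card {b \<in> Inr ` {1..M}. dist (w (Inl i)) (w b) \<le>
      kth_smallest k (Inl ` ({1..N} - {i})) (\<lambda>a. dist (w (Inl i)) (w a))}) / real k) 1)"
proof -
  have nnd: "nnd k N (\<lambda>l. w (Inl l)) i =
      kth_smallest k (Inl ` ({1..N} - {i})) (\<lambda>a. dist (w (Inl i)) (w a))" for i
    by (subst kth_smallest_reindex) (auto simp: nnd_def kth_smallest_def dist_norm norm_minus_commute)
  have "(\<Sum>j = 1..M. indicator (cball x t) (w (Inr j))) =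
      real (card {b \<in> Inr ` {1..M}. dist x (w b) \<le> t})" for x t
  proof -
    have "{b \<in> Inr ` {1..M}. dist x (w b) \<le> t} = Inr ` {j \<in> {1..M}. dist x (w (Inr j)) \<le> t}"
      by auto
    then have "card {b \<in> Inr ` {1..M}. dist x (w b) \<le> t} = card {j \<in> {1..M}. dist x (w (Inr j)) \<le> t}"
      by (simp add: card_image)
    then show ?thesis
      by (simp add: indicator_def of_bool_def sum.inter_filter[symmetric] flip: of_nat_sum)
  qed
  then show ?thesis unfolding clipped_coverage_unnorm_def nnd by simp
qed

section \<open>Expectation of the coverage via the joint law of all samples\<close>

theorem lemma1:
  fixes P :: "'w measure"
    and D :: "(real ^ 'd) measure"
    and xr xs :: "nat \<Rightarrow> 'w \<Rightarrow> real ^ 'd"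
    and N M k :: nat
  assumes prob: "prob_space P"
    and M: "1 \<le> M"
    and k: "1 \<le> k" "k \<le> N - 1"
    and indep: "prob_space.indep_vars P (\<lambda>_. borel) (case_sum xr xs) ({1..N} <+> {1..M})"
    and distr_real: "\<And>i. i \<in> {1..N} \<Longrightarrow> distr P borel (xr i) = D"
    and distr_synth: "\<And>j. j \<in> {1..M} \<Longrightarrow> distr P borel (xs j) = D"
    and no_ties: "AE x in D. \<forall>r. measure D (sphere x r) = 0"
  shows "(\<integral>\<omega>. clipped_coverage_unnorm k N M (\<lambda>i. xr i \<omega>) (\<lambda>j. xs j \<omega>) \<partial>P) =
    (\<Sum>j = 1..M. min (real j / real k) 1 * real (M choose j) *
       (Beta (real (k + j)) (real M - real j + real N - real k) / Beta (real k) (real N - real k)))"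
proof -
  interpret prob_space P by fact
  let ?I = "{1..N} <+> {1..M}"
  let ?T = "\<lambda>\<omega>. \<lambda>a\<in>?I. case_sum xr xs a \<omega>"
  let ?A = "\<lambda>i. Inl ` ({1..N} - {i}) :: (nat + nat) set" and ?B = "Inr ` {1..M} :: (nat + nat) set"
  let ?G = "\<lambda>n. min (real n / real k) 1"
  define f where "f = (\<lambda>i w. ?G (card {b \<in> ?B. dist (w (Inl i)) (w b) \<le>
    kth_smallest k (?A i) (\<lambda>a. dist (w (Inl i) :: real ^ 'd) (w a))}))"
  let ?c = "\<Sum>j = 1..M. ?G j * real (M choose j) *
       (Beta (real (k + j)) (real M - real j + real N - real k) / Beta (real k) (real N - real k))"
  \<comment> \<open>From \<open>1 \<le> k \<le> N - 1\<close> there is a first real sample; its law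
    shows that \<open>D\<close> is a Borel probability measure.\<close>
  have N: "1 \<in> {1..N}" using k by auto
  have rv: "random_variable borel (case_sum xr xs a)" if "a \<in> ?I" for a
    using indep that by (simp add: indep_vars_def)
  have D: "prob_space D" "sets D = sets borel"
    using rv[of "Inl 1"] N distr_real[OF N] by (auto intro: prob_space_distr simp: Plus_def)
  have "distr P borel (case_sum xr xs a) = D" if "a \<in> ?I" for a
    using that distr_real distr_synth by (auto simp: Plus_def)
  \<comment> \<open>Independence with common marginal \<open>D\<close> says that the joint law is a
    power of \<open>D\<close>.\<close>
  then have law: "distr P (Pi\<^sub>M ?I (\<lambda>_. borel)) ?T = Pi\<^sub>M ?I (\<lambda>_. D)"
    using indep_vars_iff_distr_eq_PiM'[of ?I "case_sum xr xs" "\<lambda>_. borel"] indep rv N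
    by (auto intro: PiM_cong)
  have T: "?T \<in> measurable P (Pi\<^sub>M ?I (\<lambda>_. borel))"
    by (intro measurable_restrict rv)
  have expectation_term: "integrable (Pi\<^sub>M ?I (\<lambda>_. D)) (f i)" "integral\<^sup>L (Pi\<^sub>M ?I (\<lambda>_. D)) (f i) = ?c"
    if i: "i \<in> {1..N}" for i
  proof -
    have I: "?I = insert (Inl i) (?A i \<union> ?B)" using i by (auto simp: Plus_def)
    have card: "card (?A i) = N - 1" "card ?B = M" using i by (simp_all add: card_image)
    have bnd: "\<bar>?G n\<bar> \<le> 1" for n by auto
    note count = integral_coverage_count[OF D no_ties, of "?A i" ?B "Inl i" k ?G 1]
    show "integrable (Pi\<^sub>M ?I (\<lambda>_. D)) (f i)"
      unfolding I f_def by (rule count(1)) (use k card bnd in auto)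
    have "integral\<^sup>L (Pi\<^sub>M ?I (\<lambda>_. D)) (f i) = (\<Sum>j = 0..M. ?G j * real (M choose j) *
      (Beta (real (k + j)) (real (N - 1 - k + 1 + M - j)) / Beta (real k) (real (N - 1 - k + 1))))"
      unfolding I f_def by (subst count(2)) (use k card bnd in auto)
    \<comment> \<open>The term \<open>j = 0\<close> vanishes because \<open>?G 0 = 0\<close>, and
      \<open>N - 1 - k + 1\<close> is \<open>N - k\<close>.\<close>
    also have "\<dots> = ?c"
      using k by (subst sum.atLeast_Suc_atMost) (auto intro!: sum.cong simp: of_nat_diff algebra_simps)
    finally show "integral\<^sup>L (Pi\<^sub>M ?I (\<lambda>_. D)) (f i) = ?c" .
  qed
  have f_meas: "f i \<in> borel_measurable (Pi\<^sub>M ?I (\<lambda>_. borel))" if "i \<in> {1..N}" for i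
  proof -
    have eq: "sets (Pi\<^sub>M ?I (\<lambda>_. D)) = sets (Pi\<^sub>M ?I (\<lambda>_. borel))"
      by (rule sets_PiM_cong[OF refl D(2)])
    show ?thesis
      using borel_measurable_integrable[OF expectation_term(1)[OF that]]
      unfolding measurable_cong_sets[OF eq refl] .
  qed
  have integrable_P: "integrable P (\<lambda>\<omega>. f i (?T \<omega>))" if i: "i \<in> {1..N}" for i
    by (rule integrable_distr[OF T]) (simp only: law expectation_term(1)[OF i])
  have expectation_P: "(\<integral>\<omega>. f i (?T \<omega>) \<partial>P) = ?c" if i: "i \<in> {1..N}" for i
    by (rule trans[OF integral_distr[OF T f_meas[OF i], symmetric]]) (simp only: law expectation_term(2)[OF i])
  have "clipped_coverage_unnorm k N M (\<lambda>i. xr i \<omega>) (\<lambda>j. xs j \<omega>) = 1 / real N * (\<Sum>i = 1..N. f i (?T \<omega>))" for \<omega>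
  proof -
    have "clipped_coverage_unnorm k N M (\<lambda>i. xr i \<omega>) (\<lambda>j. xs j \<omega>) =
      1 / real N * (\<Sum>i = 1..N. f i (\<lambda>a. case_sum xr xs a \<omega>))"
      using clipped_coverage_unnorm_eq_sum_count[of k N M "\<lambda>a. case_sum xr xs a \<omega>"] by (simp add: f_def)
    \<comment> \<open>\<open>f i\<close> reads only coordinates in \<open>?I\<close>, so restricting
      the family to \<open>?I\<close> is harmless.\<close>
    moreover have "f i (\<lambda>a. case_sum xr xs a \<omega>) = f i (?T \<omega>)" if i: "i \<in> {1..N}" for i
    proof -
      have "kth_smallest k (?A i) (\<lambda>a. dist (case_sum xr xs (Inl i) \<omega>) (case_sum xr xs a \<omega>)) =
        kth_smallest k (?A i) (\<lambda>a. dist (?T \<omega> (Inl i)) (?T \<omega> a))"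
        using i by (intro kth_smallest_cong) (auto simp: Plus_def)
      then show ?thesis
        unfolding f_def using i by (intro arg_cong[where f = ?G] arg_cong[where f = card]) (auto simp: Plus_def)
    qed
    ultimately show ?thesis by simp
  qed
  then have "(\<integral>\<omega>. clipped_coverage_unnorm k N M (\<lambda>i. xr i \<omega>) (\<lambda>j. xs j \<omega>) \<partial>P) =
    1 / real N * (\<Sum>i = 1..N. \<integral>\<omega>. f i (?T \<omega>) \<partial>P)"
    using integrable_P by (simp only: integral_mult_right_zero Bochner_Integration.integral_sum)
  also have "\<dots> = 1 / real N * (\<Sum>i = 1..N. ?c)"
    using expectation_P by (intro arg_cong[where f = "\<lambda>x. 1 / real N * x"] sum.cong refl)
  \<comment> \<open>All \<open>N\<close> terms have the same expectation, so their average is that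
    value.\<close>
  also have "\<dots> = ?c" using N by simp
  finally show ?thesis .
qed

end
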